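(* Let $N\ge 3$ and let $v_a$ be any rim vertex of the wheel graph $W_{N+1}$ with central vertex $c$. Then $$\mathcal F_{W_{N+1}}(\{c,v_a\})=\tau(W_{N+1}/\{c,v_a\})=F_{2N}.$$
   Context: The wheel graph $W_{N+1}$ ($N\ge3$) has vertex set $\{c,v_1,\ldots,v_N\}$ and edges $\{v_i,v_{i+1}\}$ (indices modulo $N$) and $\{c,v_i\}$ for $1\le i\le N$; $c$ is the central vertex and the $v_i$ are the rim vertices. For a finite connected graph $G$ and $\varnothing\ne S\subseteq V(G)$, a rooted spanning forest of $G$ with root set $S$ is a spanning forest (an acyclic subgraph containing all vertices of $G$) in which each connected component contains exactly one vertex of $S$; $\mathcal F_G(S)$ denotes the number of such forests. $G/S$ is the multigraph obtained from $G$ by identifying all vertices of $S$ into a single vertex, keeping multiple edges with their multiplicities and deleting loops. $\tau(H)$ is the number of spanning trees of $H$, where parallel edges are regarded as distinct. Fibonacci numbers: $F_0=0$, $F_1=1$, $F_{n+2}=F_{n+1}+F_n$. *)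

theory Defs
  imports "HOL-Number_Theory.Fib"
begin

text \<open>
  Undirected multigraphs. An edge is an abstract object with a set of one (loop) or two end
  vertices, so distinct edges may have the same ends.
\<close>

record ('v, 'e) multigraph =
  verts :: "'v set"
  edges :: "'e set"
  ends :: "'e \<Rightarrow> 'v set"

definition finite_multigraph :: "('v, 'e) multigraph \<Rightarrow> bool" where
  "finite_multigraph G \<longleftrightarrow> finite (verts G) \<and> finite (edges G) \<and>
     (\<forall>e \<in> edges G. ends G e \<subseteq> verts G \<and> card (ends G e) \<in> {1, 2})"

definition adjacency :: "('v, 'e) multigraph \<Rightarrow> 'v rel" where
  "adjacency G = {(u, v). \<exists>e \<in> edges G. ends G e = {u, v}}"

definition components :: "('v, 'e) multigraph \<Rightarrow> 'v set set" where
  "components G = {{v \<in> verts G. (u, v) \<in> (adjacency G)\<^sup>*} | u. u \<in> verts G}"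

definition connected_graph :: "('v, 'e) multigraph \<Rightarrow> bool" where
  "connected_graph G \<longleftrightarrow> verts G \<noteq> {} \<and>
     (\<forall>u \<in> verts G. \<forall>v \<in> verts G. (u, v) \<in> (adjacency G)\<^sup>*)"

text \<open>
  A cycle visits distinct vertices \<open>vs\<close> along distinct edges \<open>es\<close> and returns to its start. A loop
  is a cycle of length 1 and a pair of parallel edges is a cycle of length 2; distinctness of the
  edges prevents a single edge traversed back and forth from counting as a cycle.
\<close>

definition cycle :: "('v, 'e) multigraph \<Rightarrow> 'v list \<Rightarrow> 'e list \<Rightarrow> bool" where
  "cycle G vs es \<longleftrightarrow> es \<noteq> [] \<and> length vs = length es \<and> distinct vs \<and> distinct es \<and>
     set vs \<subseteq> verts G \<and> set es \<subseteq> edges G \<and>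
     (\<forall>i < length es. ends G (es ! i) = {vs ! i, vs ! (Suc i mod length es)})"

definition forest :: "('v, 'e) multigraph \<Rightarrow> bool" where
  "forest G \<longleftrightarrow> \<not> (\<exists>vs es. cycle G vs es)"

definition tree :: "('v, 'e) multigraph \<Rightarrow> bool" where
  "tree G \<longleftrightarrow> connected_graph G \<and> forest G"

text \<open>
  The total function \<open>ends\<close> is required to agree everywhere, also outside the edge set, so that a
  subgraph is determined by its vertices and edges and counting subgraphs is meaningful.
\<close>

definition subgraph :: "('v, 'e) multigraph \<Rightarrow> ('v, 'e) multigraph \<Rightarrow> bool" where
  "subgraph H G \<longleftrightarrow> verts H \<subseteq> verts G \<and> edges H \<subseteq> edges G \<and> ends H = ends G \<and>
     (\<forall>e \<in> edges H. ends H e \<subseteq> verts H)"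

definition spanning_subgraph :: "('v, 'e) multigraph \<Rightarrow> ('v, 'e) multigraph \<Rightarrow> bool" where
  "spanning_subgraph H G \<longleftrightarrow> subgraph H G \<and> verts H = verts G"

definition spanning_trees :: "('v, 'e) multigraph \<Rightarrow> ('v, 'e) multigraph set" where
  "spanning_trees G = {H. spanning_subgraph H G \<and> tree H}"

definition num_spanning_trees :: "('v, 'e) multigraph \<Rightarrow> nat" (\<open>\<tau>\<close>) where
  "\<tau> G = card (spanning_trees G)"

definition rooted_spanning_forests ::
    "('v, 'e) multigraph \<Rightarrow> 'v set \<Rightarrow> ('v, 'e) multigraph set" where
  "rooted_spanning_forests G S =
     {H. spanning_subgraph H G \<and> forest H \<and> (\<forall>C \<in> components H. \<exists>!s. s \<in> C \<and> s \<in> S)}"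

definition num_rooted_spanning_forests :: "('v, 'e) multigraph \<Rightarrow> 'v set \<Rightarrow> nat" (\<open>\<F>\<close>) where
  "\<F> G S = card (rooted_spanning_forests G S)"

text \<open>
  In \<open>G/S\<close> the merged vertex is represented by \<open>S\<close> itself and any other vertex \<open>v\<close> by \<open>{v}\<close>.
\<close>

definition merge :: "'v set \<Rightarrow> 'v \<Rightarrow> 'v set" where
  "merge S v = (if v \<in> S then S else {v})"

definition contract :: "('v, 'e) multigraph \<Rightarrow> 'v set \<Rightarrow> ('v set, 'e) multigraph" where
  "contract G S =
     \<lparr>verts = merge S ` verts G,
      edges = {e \<in> edges G. card (merge S ` ends G e) \<noteq> 1},
      ends = (\<lambda>e. merge S ` ends G e)\<rparr>"

datatype wheel_vertex = Center | Rim nat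

text \<open>
  \<open>wheel N\<close> is the wheel with \<open>N\<close> rim vertices, i.e.\ \<open>W\<^sub>N\<^sub>+\<^sub>1\<close>; the successor of rim index \<open>i\<close> in
  \<open>{1..N}\<close>, modulo \<open>N\<close>, is \<open>i mod N + 1\<close>. It is a simple graph for \<open>N \<ge> 3\<close>, so an edge is just
  the set of its ends.
\<close>

definition wheel :: "nat \<Rightarrow> (wheel_vertex, wheel_vertex set) multigraph" where
  "wheel N =
     \<lparr>verts = insert Center (Rim ` {1..N}),
      edges = {{Rim i, Rim (i mod N + 1)} | i. i \<in> {1..N}} \<union> {{Center, Rim i} | i. i \<in> {1..N}},
      ends = (\<lambda>e. e)\<rparr>"

lemma finite_multigraph_wheel:
  assumes "N \<ge> 3"
  shows "finite_multigraph (wheel N)"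
proof -
  have neq: "i \<noteq> i mod N + 1" if "i \<in> {1..N}" for i
    using that assms by (cases "i = N") auto
  have bound: "i mod N + 1 \<in> {1..N}" for i
    using assms by (simp add: Suc_leI)
  have "card {Rim i, Rim (i mod N + 1)} = 2" if "i \<in> {1..N}" for i
    using neq[OF that] by simp
  then show ?thesis
    using bound by (auto simp: finite_multigraph_def wheel_def)
qed

lemma connected_graph_wheel: "connected_graph (wheel N)"
proof -
  have "(u, Center) \<in> (adjacency (wheel N))\<^sup>* \<and> (Center, u) \<in> (adjacency (wheel N))\<^sup>*"
    if "u \<in> verts (wheel N)" for u
    using that by (fastforce simp: wheel_def adjacency_def insert_commute)
  then show ?thesis
    unfolding connected_graph_def by (auto simp: wheel_def intro: rtrancl_trans)
qed

lemma finite_multigraph_contract: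
  assumes "finite_multigraph G"
  shows "finite_multigraph (contract G S)"
proof -
  have "card (merge S ` ends G e) \<in> {1, 2}" if "e \<in> edges G" for e
  proof -
    from assms that have c: "card (ends G e) \<in> {1, 2}"
      by (auto simp: finite_multigraph_def)
    then have f: "finite (ends G e)" "ends G e \<noteq> {}"
      by (auto intro: card_ge_0_finite)
    then have "card (merge S ` ends G e) \<noteq> 0" by simp
    moreover have "card (merge S ` ends G e) \<le> 2"
      using card_image_le[OF f(1), of "merge S"] c by auto
    ultimately show ?thesis by auto
  qed
  with assms show ?thesis
    by (auto simp: finite_multigraph_def contract_def)
qed

end

theory Submission
  imports Defs "HOL-Number_Theory.Cong"
begin

text \<open>
  The spanning forests rooted at \<open>S\<close> are the inclusion-minimal edge sets along which every vertex
  reaches \<open>S\<close>; spanning trees are the case of a single root. Reaching \<open>S\<close> in \<open>G\<close> and reaching the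
  merged vertex in \<open>G/S\<close> are equivalent, which gives the first equality.

  In the wheel with \<open>S = {c, v\<^sub>a}\<close>, list the edges other than \<open>{c, v\<^sub>a}\<close> around the rim, starting at
  \<open>v\<^sub>a\<close> and alternating rim edges and spokes. In a forest every non-root vertex owns the first edge
  on its path to the root. The \<open>j\<close>-th one, counted from 0, has the candidates \<open>2j, 2j+1, 2j+2\<close>, and
  the choices come from a forest iff they are strictly increasing, i.e. no two vertices own the same
  edge. The number of such sequences of length \<open>n\<close> is \<open>F\<^bsub>2n+2\<^esub>\<close>.
\<close>

section \<open>Connectivity after removing an edge\<close>

lemma sym_adjacency: "sym (adjacency G)"
  by (auto simp: sym_def adjacency_def insert_commute)

lemma adjacency_rtrancl_sym:
  "(u, v) \<in> (adjacency G)\<^sup>* \<Longrightarrow> (v, u) \<in> (adjacency G)\<^sup>*"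
  by (rule symD[OF sym_rtrancl[OF sym_adjacency]])

lemma adjacency_rtrancl_mono:
  "T \<subseteq> U \<Longrightarrow> (adjacency (G\<lparr>edges := T\<rparr>))\<^sup>* \<subseteq> (adjacency (G\<lparr>edges := U\<rparr>))\<^sup>*"
  by (rule rtrancl_mono) (auto simp: adjacency_def)

text \<open>A walk is grown edge by edge; when it returns to a visited vertex, it is cut back to
  that vertex.\<close>

lemma simple_path:
  assumes "(x, y) \<in> (adjacency G)\<^sup>*" and "x \<in> verts G"
    and "\<And>e. e \<in> edges G \<Longrightarrow> ends G e \<subseteq> verts G"
  shows "\<exists>vs es. distinct vs \<and> length vs = Suc (length es) \<and> vs ! 0 = x \<and> last vs = y \<and>
    set vs \<subseteq> verts G \<and> set es \<subseteq> edges G \<and>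
    (\<forall>i < length es. ends G (es ! i) = {vs ! i, vs ! Suc i})"
  using assms(1)
proof (induction rule: rtrancl_induct)
  case base
  show ?case
    using assms(2) by (intro exI[of _ "[x]"] exI[of _ "[]"]) simp
next
  case (step y z)
  then obtain vs es where vs: "distinct vs" "length vs = Suc (length es)" "vs ! 0 = x"
      "last vs = y" "set vs \<subseteq> verts G" "set es \<subseteq> edges G"
    and es: "\<forall>i < length es. ends G (es ! i) = {vs ! i, vs ! Suc i}"
    by blast
  from step(2) obtain f where f: "f \<in> edges G" "ends G f = {y, z}"
    by (auto simp: adjacency_def)
  show ?case
  proof (cases "z \<in> set vs")
    case True
    then obtain k where k: "k < length vs" "vs ! k = z"
      by (auto simp: in_set_conv_nth)
    have "last (take (Suc k) vs) = z"
      using k by (simp add: take_Suc_conv_app_nth)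
    then show ?thesis
      using vs es k
      by (intro exI[of _ "take (Suc k) vs"] exI[of _ "take k es"])
        (auto dest!: in_set_takeD)
  next
    case False
    have "vs ! length es = y"
      using vs by (metis diff_Suc_1 last_conv_nth length_0_conv nat.distinct(1))
    then show ?thesis
      using vs es f False assms(3)[OF f(1)]
      by (intro exI[of _ "vs @ [z]"] exI[of _ "es @ [f]"])
        (auto simp: nth_append less_Suc_eq)
  qed
qed

text \<open>A simple path from \<open>x\<close> to \<open>y\<close> avoiding \<open>e\<close> is
  closed up by \<open>e\<close>. For a loop \<open>x = y\<close> the path is empty and the cycle has
  length 1.\<close>

lemma cycle_of_non_bridge:
  assumes e: "e \<in> edges G" "ends G e = {x, y}"
    and xy: "(x, y) \<in> (adjacency (G\<lparr>edges := edges G - {e}\<rparr>))\<^sup>*"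
    and G: "\<And>e. e \<in> edges G \<Longrightarrow> ends G e \<subseteq> verts G"
  shows "\<exists>vs es. cycle G vs es"
proof -
  have "x \<in> verts G"
    using e G by blast
  then obtain vs es where vs: "distinct vs" "length vs = Suc (length es)" "vs ! 0 = x"
      "last vs = y" "set vs \<subseteq> verts G" "set es \<subseteq> edges G - {e}"
    and es: "\<forall>i < length es. ends G (es ! i) = {vs ! i, vs ! Suc i}"
    using simple_path[OF xy] G by auto
  \<comment> \<open>On a path with distinct vertices an edge determines its position: the swapped
    match would need \<open>i = Suc j\<close> and \<open>Suc i = j\<close>.\<close>
  have "i = j" if "i < length es" "j < length es" "es ! i = es ! j" for i j
  proof -
    have "{vs ! i, vs ! Suc i} = {vs ! j, vs ! Suc j}"
      using es that by metis
    then show ?thesis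
      using vs(1,2) that by (auto simp: doubleton_eq_iff nth_eq_iff_index_eq)
  qed
  then have "distinct es"
    by (auto simp: distinct_conv_nth)
  moreover have "vs ! length es = y"
    using vs by (metis diff_Suc_1 last_conv_nth length_0_conv nat.distinct(1))
  moreover have "Suc i mod Suc (length es) = Suc i" if "i < length es" for i
    using that by simp
  ultimately have "cycle G vs (es @ [e])"
    using vs es e unfolding cycle_def
    by (auto simp: nth_append less_Suc_eq simp del: mod_less)
  then show ?thesis
    by blast
qed

lemma path_along_indices:
  assumes "i \<le> j" and "\<And>k. i \<le> k \<Longrightarrow> k < j \<Longrightarrow> (f k, f (Suc k)) \<in> R"
  shows "(f i, f j) \<in> R\<^sup>*"
  using assms
proof (induction j rule: dec_induct)
  case (step j)
  then show ?case
    by (meson less_Suc_eq rtrancl.rtrancl_into_rtrancl)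
qed simp

text \<open>The last edge of the cycle serves: the remaining edges form a path between its ends,
  empty in the case of a loop.\<close>

lemma non_bridge_of_cycle:
  assumes "cycle G vs es"
  shows "\<exists>e \<in> edges G. \<exists>x y. ends G e = {x, y} \<and>
    (x, y) \<in> (adjacency (G\<lparr>edges := edges G - {e}\<rparr>))\<^sup>*"
proof -
  define m where "m = length es - 1"
  have c: "length es = Suc m" "length vs = Suc m" "distinct es" "set es \<subseteq> edges G"
    and ends: "\<And>i. i < Suc m \<Longrightarrow> ends G (es ! i) = {vs ! i, vs ! (Suc i mod Suc m)}"
    using assms by (auto simp: cycle_def m_def)
  have "(vs ! 0, vs ! m) \<in> (adjacency (G\<lparr>edges := edges G - {es ! m}\<rparr>))\<^sup>*"
  proof (rule path_along_indices)
    fix k assume k: "k < m"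
    then have "es ! k \<in> edges G - {es ! m}"
      using c by (auto simp: nth_eq_iff_index_eq intro: nth_mem)
    moreover have "ends G (es ! k) = {vs ! k, vs ! Suc k}"
      using ends[of k] k by simp
    ultimately show "(vs ! k, vs ! Suc k) \<in> adjacency (G\<lparr>edges := edges G - {es ! m}\<rparr>)"
      by (auto simp: adjacency_def)
  qed simp
  moreover have "ends G (es ! m) = {vs ! 0, vs ! m}"
    using ends[of m] by (simp add: insert_commute)
  moreover have "es ! m \<in> edges G"
    using c by (simp add: subset_iff)
  ultimately show ?thesis
    by blast
qed

text \<open>The edge is the one by which the walk leaves \<open>r\<close> for the last time; later
  edges do not touch \<open>r\<close>, so they differ from it.\<close>

lemma leave_by_edge:
  assumes "(r, y) \<in> (adjacency G)\<^sup>*"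
  shows "y = r \<or> (\<exists>e \<in> edges G. \<exists>x. ends G e = {r, x} \<and>
    (x, y) \<in> (adjacency (G\<lparr>edges := edges G - {e}\<rparr>))\<^sup>*)"
  using assms
proof (induction rule: rtrancl_induct)
  case (step y z)
  from step(2) obtain f where f: "f \<in> edges G" "ends G f = {y, z}"
    by (auto simp: adjacency_def)
  show ?case
  proof (cases "y = r \<or> z = r")
    case True
    then show ?thesis
      using f by blast
  next
    case False
    then obtain e x where e: "e \<in> edges G" "ends G e = {r, x}"
      and xy: "(x, y) \<in> (adjacency (G\<lparr>edges := edges G - {e}\<rparr>))\<^sup>*"
      using step by blast
    then have "f \<noteq> e"
      using f False by auto
    then have "(y, z) \<in> adjacency (G\<lparr>edges := edges G - {e}\<rparr>)"
      using f by (auto simp: adjacency_def)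
    with e xy show ?thesis
      by (meson rtrancl.rtrancl_into_rtrancl)
  qed
qed simp

section \<open>Rooted forests as minimal rooting edge sets\<close>

definition reaches :: "('v, 'e) multigraph \<Rightarrow> 'v set \<Rightarrow> bool" where
  "reaches G S \<longleftrightarrow> (\<forall>v \<in> verts G. \<exists>s \<in> S. (v, s) \<in> (adjacency G)\<^sup>*)"

text \<open>Consists of edge sets rather than graphs, so that the sets for \<open>G\<close> and for
  \<open>G/S\<close>, which share their edge objects, can be compared literally. Testing single
  deletions captures inclusion-minimality because \<open>reaches\<close> is monotone in the
  edges.\<close>

definition minimal_rooting :: "('v, 'e) multigraph \<Rightarrow> 'v set \<Rightarrow> 'e set set" where
  "minimal_rooting G S = {T. T \<subseteq> edges G \<and> reaches (G\<lparr>edges := T\<rparr>) S \<and>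
     (\<forall>e \<in> T. \<not> reaches (G\<lparr>edges := T - {e}\<rparr>) S)}"

lemma reaches_mono:
  "reaches (G\<lparr>edges := T\<rparr>) S \<Longrightarrow> T \<subseteq> U \<Longrightarrow> reaches (G\<lparr>edges := U\<rparr>) S"
  using adjacency_rtrancl_mono[of T U G] by (fastforce simp: reaches_def)

text \<open>A walk to \<open>S\<close> that is about to use \<open>e\<close> stands at
  \<open>x\<close> or \<open>y\<close>, from where a route avoiding \<open>e\<close> is
  available.\<close>

lemma reaches_remove_edge:
  assumes "reaches G S" and "ends G e = {x, y}"
    and x: "\<exists>s \<in> S. (x, s) \<in> (adjacency (G\<lparr>edges := edges G - {e}\<rparr>))\<^sup>*"
    and y: "\<exists>s \<in> S. (y, s) \<in> (adjacency (G\<lparr>edges := edges G - {e}\<rparr>))\<^sup>*"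
  shows "reaches (G\<lparr>edges := edges G - {e}\<rparr>) S"
proof -
  let ?A = "adjacency (G\<lparr>edges := edges G - {e}\<rparr>)"
  have "\<exists>s \<in> S. (v, s) \<in> ?A\<^sup>*" if "(v, s) \<in> (adjacency G)\<^sup>*" "s \<in> S" for v s
    using that
  proof (induction rule: converse_rtrancl_induct)
    case (step v w)
    then obtain f where f: "f \<in> edges G" "ends G f = {v, w}"
      by (auto simp: adjacency_def)
    show ?case
    proof (cases "f = e")
      case True
      then have "v = x \<or> v = y"
        using f assms(2) by auto
      then show ?thesis
        using x y by blast
    next
      case False
      then have "(v, w) \<in> ?A"
        using f by (auto simp: adjacency_def)
      then show ?thesis
        using step by (meson converse_rtrancl_into_rtrancl)
    qed
  qed blast
  then show ?thesis
    using assms(1) by (fastforce simp: reaches_def)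
qed

text \<open>Each use of \<open>e\<close> in a walk is replaced by the detour between its
  ends.\<close>

lemma reaches_remove_non_bridge:
  assumes "reaches G S" and e: "ends G e = {x, y}"
    and xy: "(x, y) \<in> (adjacency (G\<lparr>edges := edges G - {e}\<rparr>))\<^sup>*"
    and "x \<in> verts G"
  shows "reaches (G\<lparr>edges := edges G - {e}\<rparr>) S"
proof -
  let ?A = "adjacency (G\<lparr>edges := edges G - {e}\<rparr>)"
  have yx: "(y, x) \<in> ?A\<^sup>*"
    using xy by (rule adjacency_rtrancl_sym)
  have "(v, s) \<in> ?A\<^sup>*" if "(v, s) \<in> (adjacency G)\<^sup>*" for v s
    using that
  proof (induction rule: converse_rtrancl_induct)
    case (step v w)
    then obtain f where f: "f \<in> edges G" "ends G f = {v, w}"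
      by (auto simp: adjacency_def)
    have "(v, w) \<in> ?A\<^sup>*"
    proof (cases "f = e")
      case True
      then show ?thesis
        using f e xy yx by (auto simp: doubleton_eq_iff)
    next
      case False
      then show ?thesis
        using f by (auto simp: adjacency_def)
    qed
    then show ?case
      using step by simp
  qed simp
  then show ?thesis
    using assms(1) by (fastforce simp: reaches_def)
qed

text \<open>In a minimal set, an edge of a cycle could be dropped, and so could the edge by which a
  path leaves one root towards another. Conversely, if \<open>e\<close> could be dropped, its ends
  would still reach roots; these coincide, lying in one component, so the ends stay connected
  without \<open>e\<close> and \<open>e\<close> lies on a cycle.\<close>

lemma minimal_rooting_iff:
  assumes G: "finite_multigraph G" and T: "T \<subseteq> edges G" and S: "S \<subseteq> verts G"
  defines "H \<equiv> G\<lparr>edges := T\<rparr>"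
  shows "T \<in> minimal_rooting G S \<longleftrightarrow> forest H \<and> (\<forall>C \<in> components H. \<exists>!s. s \<in> C \<and> s \<in> S)"
proof
  have ends: "ends H e \<subseteq> verts H" if "e \<in> edges H" for e
    using that G T by (auto simp: finite_multigraph_def H_def)
  {
    assume "T \<in> minimal_rooting G S"
    then have reach: "reaches H S" and
      min: "\<And>e. e \<in> edges H \<Longrightarrow> \<not> reaches (H\<lparr>edges := edges H - {e}\<rparr>) S"
      by (auto simp: minimal_rooting_def H_def)
    have "forest H"
      unfolding forest_def
    proof
      assume "\<exists>vs es. cycle H vs es"
      then obtain e x y where e: "e \<in> edges H" "ends H e = {x, y}"
        and "(x, y) \<in> (adjacency (H\<lparr>edges := edges H - {e}\<rparr>))\<^sup>*"
        using non_bridge_of_cycle by metis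
      moreover have "x \<in> verts H"
        using e ends by blast
      ultimately show False
        using reach min reaches_remove_non_bridge by metis
    qed
    moreover have "\<exists>!s. s \<in> C \<and> s \<in> S" if "C \<in> components H" for C
    proof -
      from that obtain u where u: "u \<in> verts H" "C = {v \<in> verts H. (u, v) \<in> (adjacency H)\<^sup>*}"
        by (auto simp: components_def)
      have "\<exists>s. s \<in> C \<and> s \<in> S"
        using reach u S by (auto simp: reaches_def H_def)
      moreover have "r = r'" if r: "r \<in> C \<and> r \<in> S" "r' \<in> C \<and> r' \<in> S" for r r'
      proof (rule ccontr)
        assume "r \<noteq> r'"
        moreover have "(r, r') \<in> (adjacency H)\<^sup>*"
          using r u by (auto intro: rtrancl_trans adjacency_rtrancl_sym)
        ultimately obtain e x where "e \<in> edges H" "ends H e = {r, x}"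
          "(x, r') \<in> (adjacency (H\<lparr>edges := edges H - {e}\<rparr>))\<^sup>*"
          using leave_by_edge by metis
        then show False
          using reaches_remove_edge[OF reach] min r by blast
      qed
      ultimately show ?thesis
        by blast
    qed
    ultimately show "forest H \<and> (\<forall>C \<in> components H. \<exists>!s. s \<in> C \<and> s \<in> S)"
      by blast
  }
  assume *: "forest H \<and> (\<forall>C \<in> components H. \<exists>!s. s \<in> C \<and> s \<in> S)"
  have root: "\<exists>!s. s \<in> {v \<in> verts H. (u, v) \<in> (adjacency H)\<^sup>*} \<and> s \<in> S" if "u \<in> verts H" for u
  proof (rule bspec[OF conjunct2[OF *]])
    show "{v \<in> verts H. (u, v) \<in> (adjacency H)\<^sup>*} \<in> components H"
      using that by (auto simp: components_def)
  qed
  have "reaches H S"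
    unfolding reaches_def using root by blast
  moreover have "\<not> reaches (H\<lparr>edges := T - {e}\<rparr>) S" if "e \<in> T" for e
  proof
    assume r: "reaches (H\<lparr>edges := T - {e}\<rparr>) S"
    have "card (ends G e) \<in> {1, 2}"
      using G T that by (auto simp: finite_multigraph_def)
    then obtain x y where e: "ends H e = {x, y}"
      by (auto simp: H_def card_1_singleton_iff card_2_iff)
    have xy: "x \<in> verts H" "y \<in> verts H"
      using ends[of e] e that by (auto simp: H_def)
    then obtain s s' where s: "s \<in> S" "(x, s) \<in> (adjacency (H\<lparr>edges := T - {e}\<rparr>))\<^sup>*"
      and s': "s' \<in> S" "(y, s') \<in> (adjacency (H\<lparr>edges := T - {e}\<rparr>))\<^sup>*"
      using r unfolding reaches_def
      by (metis multigraph.select_convs(1) multigraph.surjective multigraph.update_convs(2))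
    have sub: "(adjacency (H\<lparr>edges := T - {e}\<rparr>))\<^sup>* \<subseteq> (adjacency H)\<^sup>*"
      using adjacency_rtrancl_mono[of "T - {e}" T H] by (simp add: H_def)
    have "(x, y) \<in> adjacency H"
      using e that by (auto simp: adjacency_def H_def)
    then have "(x, s') \<in> (adjacency H)\<^sup>*"
      using s' sub by (meson converse_rtrancl_into_rtrancl subsetD)
    moreover have "(x, s) \<in> (adjacency H)\<^sup>*"
      using s sub by blast
    moreover have "s \<in> verts H" "s' \<in> verts H"
      using s s' S by (auto simp: H_def)
    ultimately have "s = s'"
      using root[OF xy(1)] s(1) s'(1) by blast
    then have "(x, y) \<in> (adjacency (H\<lparr>edges := T - {e}\<rparr>))\<^sup>*"
      using s s' adjacency_rtrancl_sym rtrancl_trans by metis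
    then have "\<exists>vs es. cycle H vs es"
      using cycle_of_non_bridge[of e H x y] e ends that by (simp add: H_def)
    then show False
      using * by (simp add: forest_def)
  qed
  ultimately show "T \<in> minimal_rooting G S"
    using T by (simp add: minimal_rooting_def H_def)
qed

text \<open>A spanning subgraph has the vertices and the \<open>ends\<close> of \<open>G\<close>, so
  it is determined by its edge set.\<close>

lemma num_rooted_spanning_forests_eq:
  assumes G: "finite_multigraph G" and S: "S \<subseteq> verts G"
  shows "\<F> G S = card (minimal_rooting G S)"
proof -
  have span: "spanning_subgraph H G \<longleftrightarrow> (\<exists>T \<subseteq> edges G. H = G\<lparr>edges := T\<rparr>)"
    for H :: "('a, 'b) multigraph"
    using G
    by (cases H; cases G) (auto simp: spanning_subgraph_def subgraph_def finite_multigraph_def)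
  have "rooted_spanning_forests G S = (\<lambda>T. G\<lparr>edges := T\<rparr>) ` minimal_rooting G S" (is "?L = ?R")
  proof
    show "?L \<subseteq> ?R"
      using minimal_rooting_iff[OF G _ S] by (auto simp: rooted_spanning_forests_def span)
    show "?R \<subseteq> ?L"
    proof
      fix H assume "H \<in> ?R"
      then obtain T where "T \<in> minimal_rooting G S" "H = G\<lparr>edges := T\<rparr>"
        by blast
      moreover from this have "T \<subseteq> edges G"
        by (simp add: minimal_rooting_def)
      ultimately show "H \<in> ?L"
        using minimal_rooting_iff[OF G _ S] by (auto simp: rooted_spanning_forests_def span)
    qed
  qed
  moreover have "inj_on (\<lambda>T. G\<lparr>edges := T\<rparr>) (minimal_rooting G S)"
  proof (rule inj_onI)
    fix T U assume "G\<lparr>edges := T\<rparr> = G\<lparr>edges := U\<rparr>"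
    then have "edges (G\<lparr>edges := T\<rparr>) = edges (G\<lparr>edges := U\<rparr>)"
      by (rule arg_cong)
    then show "T = U"
      by simp
  qed
  ultimately show ?thesis
    by (simp add: num_rooted_spanning_forests_def card_image)
qed

text \<open>Connectedness amounts to every component containing \<open>r\<close>, since all vertices
  are then joined through \<open>r\<close>.\<close>

lemma spanning_trees_eq_rooted_spanning_forests:
  assumes "r \<in> verts G"
  shows "spanning_trees G = rooted_spanning_forests G {r}"
proof -
  have "connected_graph H \<longleftrightarrow> (\<forall>C \<in> components H. \<exists>!s. s \<in> C \<and> s \<in> {r})"
    if "verts H = verts G" for H :: "('a, 'b) multigraph"
  proof -
    have "connected_graph H \<longleftrightarrow> (\<forall>u \<in> verts H. (u, r) \<in> (adjacency H)\<^sup>*)"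
      using that assms unfolding connected_graph_def
      by (metis adjacency_rtrancl_sym emptyE rtrancl_trans)
    also have "\<dots> \<longleftrightarrow> (\<forall>C \<in> components H. r \<in> C)"
      using that assms by (auto simp: components_def)
    finally show ?thesis
      by auto
  qed
  then show ?thesis
    by (auto simp: spanning_trees_def rooted_spanning_forests_def tree_def spanning_subgraph_def)
qed

section \<open>Contraction\<close>

lemma merge_eq_self_iff: "merge S v = S \<longleftrightarrow> v \<in> S"
  by (auto simp: merge_def)

lemma merge_eq_iff: "v \<notin> S \<Longrightarrow> merge S u = merge S v \<longleftrightarrow> u = v"
  by (auto simp: merge_def)

text \<open>Walks in \<open>G\<close> project to \<open>G/S\<close>. A walk in \<open>G/S\<close>
  lifts up to its first visit to the merged vertex, because every other vertex has a single
  preimage. \<open>T\<close> may contain edges that contraction deletes; in the quotient they are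
  only loops.\<close>

lemma reaches_contract_iff:
  assumes G: "finite_multigraph G" and T: "T \<subseteq> edges G"
  shows "reaches ((contract G S)\<lparr>edges := T\<rparr>) {S} \<longleftrightarrow> reaches (G\<lparr>edges := T\<rparr>) S"
proof
  let ?A = "adjacency (G\<lparr>edges := T\<rparr>)" and ?B = "adjacency ((contract G S)\<lparr>edges := T\<rparr>)"
  assume l: "reaches ((contract G S)\<lparr>edges := T\<rparr>) {S}"
  \<comment> \<open>Quantifying over all preimages of \<open>X\<close> lets the induction hypothesis
    apply to whichever end the lifted edge has over \<open>Y\<close>.\<close>
  have "\<forall>v. X = merge S v \<longrightarrow> (\<exists>s \<in> S. (v, s) \<in> ?A\<^sup>*)" if "(X, S) \<in> ?B\<^sup>*" for X
    using that
  proof (induction rule: converse_rtrancl_induct)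
    case base
    then show ?case
      by (metis merge_eq_self_iff rtrancl.rtrancl_refl)
  next
    case (step X Y)
    then obtain f where f: "f \<in> T" "merge S ` ends G f = {X, Y}"
      by (auto simp: adjacency_def contract_def)
    have "card (ends G f) \<in> {1, 2}"
      using G T f by (auto simp: finite_multigraph_def)
    then obtain x y where "ends G f = {x, y}"
      by (auto simp: card_1_singleton_iff card_2_iff)
    then obtain p q where pq: "ends G f = {p, q}" "merge S p = X" "merge S q = Y"
      using f by (auto simp: doubleton_eq_iff insert_commute)
    then have adj: "(p, q) \<in> ?A"
      using f by (auto simp: adjacency_def)
    show ?case
    proof (intro allI impI)
      fix v assume v: "X = merge S v"
      show "\<exists>s \<in> S. (v, s) \<in> ?A\<^sup>*"
      proof (cases "v \<in> S")
        case False
        then have "p = v"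
          using v pq by (metis merge_eq_iff)
        then show ?thesis
          using step.IH pq adj by (metis converse_rtrancl_into_rtrancl)
      qed blast
    qed
  qed
  then show "reaches (G\<lparr>edges := T\<rparr>) S"
    using l by (auto simp: reaches_def contract_def)
next
  let ?A = "adjacency (G\<lparr>edges := T\<rparr>)" and ?B = "adjacency ((contract G S)\<lparr>edges := T\<rparr>)"
  assume r: "reaches (G\<lparr>edges := T\<rparr>) S"
  have step: "(merge S u, merge S v) \<in> ?B" if "(u, v) \<in> ?A" for u v
    using that by (fastforce simp: adjacency_def contract_def)
  have "(merge S u, merge S v) \<in> ?B\<^sup>*" if "(u, v) \<in> ?A\<^sup>*" for u v
    using that by (induction rule: rtrancl_induct) (auto intro: step rtrancl.rtrancl_into_rtrancl)
  then have "(merge S v, S) \<in> ?B\<^sup>*" if "(v, s) \<in> ?A\<^sup>*" "s \<in> S" for v s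
    using that by (metis merge_eq_self_iff)
  then show "reaches ((contract G S)\<lparr>edges := T\<rparr>) {S}"
    using r by (fastforce simp: reaches_def contract_def)
qed

text \<open>Reachability agrees for every edge set, so only the ambient edge sets differ. An edge
  deleted by contraction joins two roots or is a loop; either way it could be dropped, so no minimal
  set contains it.\<close>

lemma minimal_rooting_contract:
  assumes G: "finite_multigraph G"
  shows "minimal_rooting (contract G S) {S} = minimal_rooting G S"
proof -
  have "card (merge S ` ends G e) \<noteq> 1" if T: "T \<in> minimal_rooting G S" and e: "e \<in> T" for T e
  proof
    let ?H = "G\<lparr>edges := T\<rparr>"
    assume c: "card (merge S ` ends G e) = 1"
    have reach: "reaches ?H S" "\<not> reaches (?H\<lparr>edges := edges ?H - {e}\<rparr>) S"
      and eG: "card (ends G e) \<in> {1, 2}" "ends G e \<subseteq> verts G"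
      using T e G by (auto simp: minimal_rooting_def finite_multigraph_def)
    from eG(1) obtain x y where xy: "ends ?H e = {x, y}"
      by (auto simp: card_1_singleton_iff card_2_iff)
    have "merge S x = merge S y"
      using c xy by (auto simp: card_1_singleton_iff)
    then consider "x \<in> S" "y \<in> S" | "x = y"
      by (metis merge_eq_iff merge_eq_self_iff)
    then show False
    proof cases
      case 1
      then show ?thesis
        using reaches_remove_edge[OF reach(1) xy] reach(2) by blast
    next
      case 2
      then show ?thesis
        using reaches_remove_non_bridge[OF reach(1) xy] reach(2) xy eG(2) by simp
    qed
  qed
  then have "T \<subseteq> edges (contract G S)" if "T \<in> minimal_rooting G S" for T
    using that by (auto simp: contract_def minimal_rooting_def)
  moreover have "T \<in> minimal_rooting (contract G S) {S} \<longleftrightarrow> T \<in> minimal_rooting G S"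
    if "T \<subseteq> edges (contract G S)" for T
  proof -
    have "T \<subseteq> edges G" "\<And>e. T - {e} \<subseteq> edges G"
      using that by (auto simp: contract_def)
    then show ?thesis
      using that reaches_contract_iff[OF G] by (simp add: minimal_rooting_def)
  qed
  moreover have "T \<subseteq> edges (contract G S)" if "T \<in> minimal_rooting (contract G S) {S}" for T
    using that by (simp add: minimal_rooting_def)
  ultimately show ?thesis
    by (intro equalityI subsetI) metis+
qed

lemma num_rooted_spanning_forests_eq_contract:
  assumes G: "finite_multigraph G" and S: "S \<subseteq> verts G" "S \<noteq> {}"
  shows "\<F> G S = \<tau> (contract G S)"
proof -
  have r: "S \<in> verts (contract G S)"
    using S by (force simp: contract_def merge_def)
  have "\<tau> (contract G S) = \<F> (contract G S) {S}"
    by (simp add: num_spanning_trees_def num_rooted_spanning_forests_def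
        spanning_trees_eq_rooted_spanning_forests[OF r])
  also have "\<dots> = card (minimal_rooting (contract G S) {S})"
    using r by (simp add: num_rooted_spanning_forests_eq finite_multigraph_contract G)
  also have "\<dots> = \<F> G S"
    by (simp add: minimal_rooting_contract num_rooted_spanning_forests_eq G S)
  finally show ?thesis ..
qed

section \<open>Staircase sequences\<close>

definition staircases :: "nat \<Rightarrow> nat list set" where
  "staircases n = {t. length t = n \<and> sorted_wrt (<) t \<and> (\<forall>j < n. t ! j \<in> {2 * j..2 * j + 2})}"

lemma append_in_staircases_iff:
  "t @ [x] \<in> staircases (Suc n) \<longleftrightarrow>
     t \<in> staircases n \<and> x \<in> {2 * n..2 * n + 2} \<and> (\<forall>y \<in> set t. y < x)"
  by (auto simp: staircases_def sorted_wrt_append nth_append less_Suc_eq)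

lemma staircases_less:
  assumes "t \<in> staircases n" and "y \<in> set t"
  shows "y < 2 * n + 1"
proof -
  from assms obtain j where "j < n" "y = t ! j"
    by (auto simp: staircases_def in_set_conv_nth)
  then have "y \<le> 2 * j + 2"
    using assms(1) by (auto simp: staircases_def)
  then show ?thesis
    using \<open>j < n\<close> by simp
qed

text \<open>The earlier entries are at most \<open>2 * n\<close>, so the last entries
  \<open>2 * n + 1\<close> and \<open>2 * n + 2\<close> are always allowed, while
  \<open>2 * n\<close> requires that it has not been taken.\<close>

lemma staircases_Suc:
  "staircases (Suc n) = (\<lambda>t. t @ [2 * n + 2]) ` staircases n \<union> (\<lambda>t. t @ [2 * n + 1]) ` staircases n
     \<union> (\<lambda>t. t @ [2 * n]) ` {t \<in> staircases n. \<forall>y \<in> set t. y < 2 * n}" (is "_ = ?R")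
proof
  show "staircases (Suc n) \<subseteq> ?R"
  proof
    fix s assume s: "s \<in> staircases (Suc n)"
    then have "s \<noteq> []"
      by (auto simp: staircases_def)
    then obtain t x where tx: "s = t @ [x]"
      by (metis rev_exhaust)
    then have "t \<in> staircases n" "\<forall>y \<in> set t. y < x" "x = 2 * n \<or> x = 2 * n + 1 \<or> x = 2 * n + 2"
      using s by (auto simp: append_in_staircases_iff)
    then show "s \<in> ?R"
      using tx by blast
  qed
  have "y < 2 * n + 1" "y < 2 * n + 2" if "t \<in> staircases n" "y \<in> set t" for t y
    using staircases_less[OF that] by simp_all
  then show "?R \<subseteq> staircases (Suc n)"
    by (auto simp: append_in_staircases_iff)
qed

text \<open>The staircases avoiding \<open>2 * n\<close> must be counted alongside. With totals
  \<open>s\<close> and restricted counts \<open>r\<close>, the recursion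
  \<open>s' = 2 s + r\<close>, \<open>r' = s + r\<close> is two Fibonacci steps.\<close>

lemma card_staircases:
  "finite (staircases n) \<and> card (staircases n) = fib (2 * n + 2) \<and>
   card {t \<in> staircases n. \<forall>y \<in> set t. y < 2 * n} = fib (2 * n + 1)"
proof (induction n)
  case 0
  have "staircases 0 = {[]}"
    by (auto simp: staircases_def)
  then show ?case
    by simp
next
  case (Suc n)
  let ?S = "staircases n" and ?R = "{t \<in> staircases n. \<forall>y \<in> set t. y < 2 * n}"
  have inj: "inj_on (\<lambda>t. t @ [x]) A" for x :: nat and A
    by (auto simp: inj_on_def)
  have fin: "finite ?S" "finite ?R"
    using Suc by auto
  \<comment> \<open>Among the three possible last entries only \<open>2 * n + 2\<close> violates the
    bound.\<close>
  have low: "{t \<in> staircases (Suc n). \<forall>y \<in> set t. y < 2 * Suc n} =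
      (\<lambda>t. t @ [2 * n + 1]) ` ?S \<union> (\<lambda>t. t @ [2 * n]) ` ?R"
    unfolding staircases_Suc by (auto dest: staircases_less)
  have "card {t \<in> staircases (Suc n). \<forall>y \<in> set t. y < 2 * Suc n} = card ?S + card ?R"
    unfolding low using fin by (subst card_Un_disjoint) (auto simp: card_image[OF inj])
  \<comment> \<open>The three images are disjoint because their lists end differently.\<close>
  moreover have "card (staircases (Suc n)) = card ?S + card ?S + card ?R"
    unfolding staircases_Suc using fin
    by (subst card_Un_disjoint, force, force, force)+ (simp add: card_image[OF inj])
  moreover have "finite (staircases (Suc n))"
    unfolding staircases_Suc using fin by simp
  ultimately show ?case
    using Suc by (simp add: numeral_eq_Suc)
qed

section \<open>The wheel\<close>

text \<open>\<open>d\<close> is the distance to \<open>S\<close>, and \<open>u\<close> is the second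
  vertex of a shortest walk. The strict decrease later prevents two neighbours from choosing each
  other.\<close>

lemma distance_decreasing_step:
  assumes "(v, s) \<in> R\<^sup>*" and "s \<in> S" and "v \<notin> S"
  defines "d \<equiv> \<lambda>v. LEAST n. \<exists>s \<in> S. (v, s) \<in> R ^^ n"
  shows "\<exists>u. (v, u) \<in> R \<and> d u < d v"
proof -
  have "\<exists>n. \<exists>s \<in> S. (v, s) \<in> R ^^ n"
    using assms(1,2) by (auto simp: rtrancl_power)
  then have "\<exists>s \<in> S. (v, s) \<in> R ^^ d v"
    unfolding d_def by (rule LeastI_ex)
  then obtain s where s: "s \<in> S" "(v, s) \<in> R ^^ d v"
    by blast
  with assms(3) obtain n where n: "d v = Suc n"
    by (cases "d v") auto
  with s obtain u where u: "(v, u) \<in> R" "(u, s) \<in> R ^^ n"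
    by (metis relpow_Suc_D2)
  have "d u \<le> n"
    unfolding d_def using u s(1) by (auto intro: Least_le)
  with u n show ?thesis
    by auto
qed

section \<open>Cyclic coordinates on the wheel, starting at the root rim vertex\<close>

locale rooted_wheel =
  fixes N a :: nat
  assumes N: "N \<ge> 3" and a: "a \<in> {1..N}"
begin

text \<open>Position \<open>k\<close> counted from \<open>Rim a\<close>; the shifts by 1 account for
  rim indices starting at 1. By periodicity \<open>rim 0\<close> and \<open>rim N\<close> are both
  the root, and the non-root rim vertices are \<open>rim (Suc j)\<close> for
  \<open>j < N - 1\<close>.\<close>

definition rim :: "nat \<Rightarrow> wheel_vertex" where
  "rim k = Rim ((a - 1 + k) mod N + 1)"

text \<open>Even indices are rim edges, odd ones spokes, so that \<open>rim (Suc j)\<close> meets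
  exactly \<open>2 * j\<close>, \<open>2 * j + 1\<close> and \<open>2 * j + 2\<close>. Indices below
  \<open>2 * N - 1\<close> omit only the spoke at \<open>Rim a\<close>, which joins the two
  roots.\<close>

definition edge :: "nat \<Rightarrow> wheel_vertex set" where
  "edge m = (if even m then {rim (m div 2), rim (Suc (m div 2))} else {Center, rim (Suc (m div 2))})"

abbreviation roots :: "wheel_vertex set" where
  "roots \<equiv> {Center, Rim a}"

lemma rim_eq_iff: "rim i = rim j \<longleftrightarrow> i mod N = j mod N"
  using cong_add_lcancel_nat[of "a - 1" i j N] by (simp add: rim_def cong_def)

lemma rim_neq_Center [simp]: "rim k \<noteq> Center" "Center \<noteq> rim k"
  by (simp_all add: rim_def)

lemma rim_0: "rim 0 = Rim a" and rim_N: "rim N = Rim a"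
proof -
  have "(a - 1) mod N = a - 1"
    using a by (intro mod_less) auto
  then show "rim 0 = Rim a"
    using a by (simp add: rim_def)
  then show "rim N = Rim a"
    using rim_eq_iff[of N 0] by simp
qed

lemma Rim_image: "Rim ` {1..N} = rim ` {..<N}"
proof -
  have "rim ` {..<N} \<subseteq> Rim ` {1..N}"
    using N by (auto simp: rim_def Suc_le_eq)
  moreover have "card (rim ` {..<N}) = card (Rim ` {1..N})"
    by (subst (1 2) card_image) (auto simp: inj_on_def rim_eq_iff)
  ultimately show ?thesis
    by (metis card_subset_eq finite_atLeastAtMost finite_imageI)
qed

lemma verts_wheel: "verts (wheel N) = insert Center (rim ` {..<N})"
  using Rim_image by (simp add: wheel_def)

lemma ends_wheel [simp]: "ends (wheel N) e = e"
  by (simp add: wheel_def)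

lemma edges_wheel:
  "edges (wheel N) = {{rim k, rim (Suc k)} | k. k < N} \<union> {{Center, rim k} | k. k < N}"
proof -
  \<comment> \<open>Rotation of the rim by one step. It writes both edge families as images of the
    set of rim vertices, which can then be reindexed by \<open>rim\<close>.\<close>
  define nxt where "nxt v = (case v of Rim i \<Rightarrow> Rim (i mod N + 1) | Center \<Rightarrow> Center)" for v
  have nxt: "nxt (rim k) = rim (Suc k)" for k
    by (simp add: nxt_def rim_def mod_simps)
  have "edges (wheel N) = (\<lambda>v. {v, nxt v}) ` Rim ` {1..N} \<union> (\<lambda>v. {Center, v}) ` Rim ` {1..N}"
    by (auto simp: wheel_def nxt_def)
  also have "\<dots> = {{rim k, rim (Suc k)} | k. k < N} \<union> {{Center, rim k} | k. k < N}"
    unfolding Rim_image by (auto simp: nxt)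
  finally show ?thesis .
qed

lemma edge_in_wheel:
  assumes "m < 2 * N - 1"
  shows "edge m \<in> edges (wheel N)"
proof (cases "even m")
  case True
  then have "m div 2 < N"
    using assms by auto
  with True show ?thesis
    by (auto simp: edge_def edges_wheel)
next
  case False
  then have "Suc (m div 2) < N"
    using assms by (auto elim!: oddE)
  with False show ?thesis
    by (auto simp: edge_def edges_wheel)
qed

lemma inj_on_edge: "inj_on edge {..<2 * N - 1}"
proof (rule inj_onI)
  fix l m assume lm: "l \<in> {..<2 * N - 1}" "m \<in> {..<2 * N - 1}" and eq: "edge l = edge m"
  have par: "even l = even m"
    using eq by (auto simp: edge_def doubleton_eq_iff split: if_splits)
  show "l = m"
  proof (cases "even m")
    case True
    have bd: "l div 2 < N" "m div 2 < N"
      using lm by auto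
    have "rim (l div 2) = rim (m div 2) \<or>
        rim (l div 2) = rim (Suc (m div 2)) \<and> rim (Suc (l div 2)) = rim (m div 2)"
      using eq par True by (auto simp: edge_def doubleton_eq_iff)
    \<comment> \<open>The swapped match would give 2 = 0 modulo \<open>N\<close>, impossible for
      \<open>N >= 3\<close>.\<close>
    then have "l div 2 = m div 2"
      using bd N by (auto simp: rim_eq_iff mod_Suc split: if_splits)
    then show ?thesis
      using par True by (metis even_two_times_div_two)
  next
    case False
    have bd: "Suc (l div 2) < N" "Suc (m div 2) < N"
      using lm par False by (auto elim!: oddE)
    have "rim (Suc (l div 2)) = rim (Suc (m div 2))"
      using eq par False by (auto simp: edge_def doubleton_eq_iff)
    then have "l div 2 = m div 2"
      using bd by (simp add: rim_eq_iff)
    then show ?thesis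
      using par False by (metis odd_two_times_div_two_succ)
  qed
qed

text \<open>Recovers from the first edge of a walk both its candidate index and the direction
  taken.\<close>

lemma edges_at_rim:
  assumes e: "e \<in> edges (wheel N)" "e = {rim (Suc j), u}" and j: "Suc j < N"
  shows "e = edge (2 * j) \<and> u = rim j \<or> e = edge (2 * j + 1) \<and> u = Center \<or>
    e = edge (2 * j + 2) \<and> u = rim (Suc (Suc j))"
proof -
  have eqs: "edge (2 * j) = {rim j, rim (Suc j)}" "edge (2 * j + 1) = {Center, rim (Suc j)}"
    "edge (2 * j + 2) = {rim (Suc j), rim (Suc (Suc j))}"
    by (simp_all add: edge_def)
  from e(1) consider k where "k < N" "e = {rim k, rim (Suc k)}" | k where "k < N" "e = {Center, rim k}"
    by (auto simp: edges_wheel)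
  then show ?thesis
  proof cases
    case 1
    then consider "rim (Suc j) = rim k" "u = rim (Suc k)" | "rim (Suc j) = rim (Suc k)" "u = rim k"
      using e(2) by (auto simp: doubleton_eq_iff)
    then show ?thesis
    proof cases
      case 1
      then have "k = Suc j"
        using j \<open>k < N\<close> by (simp add: rim_eq_iff)
      then show ?thesis
        using 1 e(2) eqs by simp
    next
      case 2
      then have "k = j"
        using j \<open>k < N\<close> by (auto simp: rim_eq_iff mod_Suc split: if_splits)
      then show ?thesis
        using 2 e(2) eqs by (simp add: insert_commute)
    qed
  next
    case 2
    then have "u = Center"
      using e(2) by (auto simp: doubleton_eq_iff)
    then show ?thesis
      using e(2) eqs by (simp add: insert_commute)
  qed
qed

section \<open>Staircases as rooting edge sets\<close>

lemma staircases_set_bound: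
  "t \<in> staircases (N - 1) \<Longrightarrow> set t \<subseteq> {..<2 * N - 1}"
  using staircases_less[of t "N - 1"] N by fastforce

text \<open>Entry \<open>j\<close> sends \<open>rim (Suc j)\<close> backward, to the center or
  forward. Strict increase forbids two neighbours from pointing at each other, so following the
  entries keeps one direction until a spoke or the root at \<open>rim 0\<close> or
  \<open>rim N\<close> is met.\<close>

lemma reaches_staircase:
  assumes t: "t \<in> staircases (N - 1)"
  shows "reaches ((wheel N)\<lparr>edges := edge ` set t\<rparr>) roots"
proof -
  let ?A = "adjacency ((wheel N)\<lparr>edges := edge ` set t\<rparr>)"
  let ?P = "\<lambda>k. \<exists>s \<in> roots. (rim k, s) \<in> ?A\<^sup>*"
  have len: "length t = N - 1" and range: "\<And>j. j < N - 1 \<Longrightarrow> t ! j \<in> {2 * j..2 * j + 2}"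
    and less: "\<And>j. Suc j < N - 1 \<Longrightarrow> t ! j < t ! Suc j"
    using t by (auto simp: staircases_def sorted_wrt_iff_nth_less)
  have adj: "(u, v) \<in> ?A" if "j < N - 1" "edge (t ! j) = {u, v}" for j u v
    using that len by (force simp: adjacency_def)
  have step: "?P k" if "(rim k, rim l) \<in> ?A" "?P l" for k l
    using that by (meson converse_rtrancl_into_rtrancl)
  have spoke: "?P (Suc j)" if "j < N - 1" "t ! j = 2 * j + 1" for j
  proof -
    have "edge (t ! j) = {rim (Suc j), Center}"
      using that by (auto simp: edge_def)
    then show ?thesis
      using adj that(1) by blast
  qed
  have left: "(rim (Suc j), rim j) \<in> ?A" if "j < N - 1" "t ! j = 2 * j" for j
    using that by (intro adj[of j]) (auto simp: edge_def)
  have right: "(rim (Suc j), rim (Suc (Suc j))) \<in> ?A" if "j < N - 1" "t ! j = 2 * j + 2" for j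
    using that by (intro adj[of j]) (auto simp: edge_def)
  have P0: "?P 0" "?P N"
    using rim_0 rim_N by auto
  \<comment> \<open>If vertex \<open>Suc (Suc j)\<close> points backward, its entry is
    \<open>2 * j + 2\<close>, so the preceding entry is at most \<open>2 * j + 1\<close> and the
    induction hypothesis applies.\<close>
  have down: "?P (Suc j)" if "j < N - 1" "t ! j \<le> 2 * j + 1" for j
    using that
  proof (induction j)
    case 0
    show ?case
    proof (cases "t ! 0 = 0")
      case True
      then show ?thesis
        using step[OF left[of 0] P0(1)] 0 by simp
    next
      case False
      then show ?thesis
        using spoke[of 0] 0 by simp
    qed
  next
    case (Suc j)
    show ?case
    proof (cases "t ! Suc j = 2 * Suc j")
      case True
      then have "?P (Suc j)"
        using Suc less[of j] by simp
      then show ?thesis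
        using step left[OF Suc.prems(1) True] by blast
    next
      case False
      then show ?thesis
        using spoke[of "Suc j"] range[of "Suc j"] Suc.prems by auto
    qed
  qed
  \<comment> \<open>The mirror image, by induction downward from the last index
    \<open>N - 2\<close>, whose forward neighbour is the root \<open>rim N\<close>.\<close>
  have up: "?P (Suc j)" if "j \<le> N - 2" "t ! j \<ge> 2 * j + 1" for j
    using that
  proof (induction j rule: inc_induct)
    case base
    have eqs: "Suc (Suc (N - 2)) = N" "N - 2 < N - 1"
      using N by auto
    show ?case
    proof (cases "t ! (N - 2) = 2 * (N - 2) + 2")
      case True
      then show ?thesis
        using step[OF right[OF eqs(2) True]] P0(2) eqs(1) by metis
    next
      case False
      then show ?thesis
        using spoke[OF eqs(2)] range[OF eqs(2)] base by auto
    qed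
  next
    case (step j)
    then have j: "j < N - 1" "Suc j < N - 1"
      by auto
    show ?case
    proof (cases "t ! j = 2 * j + 2")
      case True
      then have "?P (Suc (Suc j))"
        using step.IH less[OF j(2)] by simp
      then show ?thesis
        using right[OF j(1) True] by (meson converse_rtrancl_into_rtrancl)
    next
      case False
      then show ?thesis
        using spoke[OF j(1)] range[OF j(1)] step.prems by auto
    qed
  qed
  have "?P k" if "k < N" for k
  proof (cases k)
    case 0
    then show ?thesis
      using P0 by simp
  next
    case (Suc j)
    then show ?thesis
      using down[of j] up[of j] that by (cases "t ! j \<le> 2 * j + 1") auto
  qed
  then show ?thesis
    by (auto simp: reaches_def verts_wheel)
qed

text \<open>
  Every non-root vertex has a neighbour in \<open>T\<close> that is closer to the roots. Choosing such an edge at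
  every vertex gives a staircase: two consecutive rim vertices cannot both choose the edge joining
  them.
\<close>

lemma staircase_of_reaches:
  assumes T: "T \<subseteq> edges (wheel N)" and reach: "reaches ((wheel N)\<lparr>edges := T\<rparr>) roots"
  shows "\<exists>t \<in> staircases (N - 1). edge ` set t \<subseteq> T"
proof -
  let ?A = "adjacency ((wheel N)\<lparr>edges := T\<rparr>)"
  define d where "d v = (LEAST n. \<exists>s \<in> roots. (v, s) \<in> ?A ^^ n)" for v
  have ex: "\<exists>m. edge m \<in> T \<and> (m = 2 * j \<and> d (rim j) < d (rim (Suc j)) \<or> m = 2 * j + 1 \<or>
      m = 2 * j + 2 \<and> d (rim (Suc (Suc j))) < d (rim (Suc j)))" if j: "j < N - 1" for j
  proof -
    have "rim (Suc j) \<noteq> Rim a"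
      using j rim_eq_iff[of "Suc j" 0] by (simp add: rim_0)
    moreover obtain s where "s \<in> roots" "(rim (Suc j), s) \<in> ?A\<^sup>*"
      using reach j by (fastforce simp: reaches_def verts_wheel)
    ultimately obtain u where u: "(rim (Suc j), u) \<in> ?A" "d u < d (rim (Suc j))"
      using distance_decreasing_step[of "rim (Suc j)" s ?A roots] unfolding d_def by auto
    then obtain e where e: "e \<in> T" "e = {rim (Suc j), u}"
      by (auto simp: adjacency_def)
    moreover have "e \<in> edges (wheel N)" "Suc j < N"
      using e T j by auto
    ultimately show ?thesis
      using edges_at_rim[of e j u] u(2) by metis
  qed
  then obtain c where c: "\<And>j. j < N - 1 \<Longrightarrow> edge (c j) \<in> T \<and>
      (c j = 2 * j \<and> d (rim j) < d (rim (Suc j)) \<or> c j = 2 * j + 1 \<or>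
       c j = 2 * j + 2 \<and> d (rim (Suc (Suc j))) < d (rim (Suc j)))"
    by metis
  have range: "2 * j \<le> c j" "c j \<le> 2 * j + 2" if "j < N - 1" for j
    using c[OF that] by auto
  \<comment> \<open>For adjacent indices equality would force opposite strict inequalities between
    the same two distances; for indices further apart the candidate ranges are disjoint.\<close>
  have "c i < c j" if "i < j" "j < N - 1" for i j
  proof (cases "j = Suc i")
    case True
    then show ?thesis
      using c[of i] c[of j] that by auto
  next
    case False
    then show ?thesis
      using range[of i] range[of j] that by simp
  qed
  then have "map c [0..<N - 1] \<in> staircases (N - 1)"
    using range by (auto simp: staircases_def sorted_wrt_iff_nth_less)
  moreover have "edge ` set (map c [0..<N - 1]) \<subseteq> T"
    using c by auto
  ultimately show ?thesis
    by blast
qed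

lemma card_edge_image:
  assumes "t \<in> staircases (N - 1)"
  shows "card (edge ` set t) = N - 1"
proof -
  have "card (edge ` set t) = card (set t)"
    using staircases_set_bound[OF assms] inj_on_edge by (metis card_image inj_on_subset)
  also have "\<dots> = N - 1"
    using assms by (auto simp: staircases_def strict_sorted_iff distinct_card)
  finally show ?thesis .
qed

text \<open>A minimal set equals the staircase set that it contains. Conversely, if an edge of a
  staircase set could be dropped, the rest would contain a staircase set, but all of these have size
  \<open>N - 1\<close>.\<close>

lemma minimal_rooting_wheel:
  "minimal_rooting (wheel N) roots = (\<lambda>t. edge ` set t) ` staircases (N - 1)" (is "?L = ?R")
proof
  show "?L \<subseteq> ?R"
  proof
    fix T assume "T \<in> ?L"
    then have T: "T \<subseteq> edges (wheel N)" "reaches ((wheel N)\<lparr>edges := T\<rparr>) roots"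
      "\<And>e. e \<in> T \<Longrightarrow> \<not> reaches ((wheel N)\<lparr>edges := T - {e}\<rparr>) roots"
      by (auto simp: minimal_rooting_def)
    then obtain t where t: "t \<in> staircases (N - 1)" "edge ` set t \<subseteq> T"
      using staircase_of_reaches by blast
    have "e \<in> edge ` set t" if "e \<in> T" for e
    proof (rule ccontr)
      assume "e \<notin> edge ` set t"
      then have "edge ` set t \<subseteq> T - {e}"
        using t by blast
      then show False
        using reaches_mono[OF reaches_staircase[OF t(1)]] T(3)[OF that] by blast
    qed
    then show "T \<in> ?R"
      using t by blast
  qed
  show "?R \<subseteq> ?L"
  proof
    fix T assume "T \<in> ?R"
    then obtain t where t: "t \<in> staircases (N - 1)" and Tt: "T = edge ` set t"
      by blast
    have T: "T \<subseteq> edges (wheel N)"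
      using staircases_set_bound[OF t] edge_in_wheel Tt by auto
    moreover have "\<not> reaches ((wheel N)\<lparr>edges := T - {e}\<rparr>) roots" if "e \<in> T" for e
    proof
      assume "reaches ((wheel N)\<lparr>edges := T - {e}\<rparr>) roots"
      then obtain u where "u \<in> staircases (N - 1)" "edge ` set u \<subseteq> T - {e}"
        using staircase_of_reaches[of "T - {e}"] T by blast
      then have "N - 1 \<le> card (T - {e})"
        using card_edge_image[of u] card_mono[of "T - {e}" "edge ` set u"] Tt by simp
      then show False
        using card_edge_image[OF t] that Tt N by (simp add: card_Diff_singleton)
    qed
    ultimately show "T \<in> ?L"
      using reaches_staircase[OF t] Tt by (simp add: minimal_rooting_def)
  qed
qed

lemma num_rooted_spanning_forests_wheel: "\<F> (wheel N) roots = fib (2 * N)"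
proof -
  \<comment> \<open>A staircase is recovered from its edges as the increasing list of their
    indices.\<close>
  have "inj_on (\<lambda>t. edge ` set t) (staircases (N - 1))"
  proof (rule inj_onI)
    fix t u assume tu: "t \<in> staircases (N - 1)" "u \<in> staircases (N - 1)"
      and "edge ` set t = edge ` set u"
    then have "set t = set u"
      using inj_on_image_eq_iff[OF inj_on_edge] staircases_set_bound by metis
    then show "t = u"
      using tu strict_sorted_equal by (auto simp: staircases_def)
  qed
  moreover have "roots \<subseteq> verts (wheel N)"
    using a by (auto simp: wheel_def)
  ultimately have "\<F> (wheel N) roots = fib (2 * (N - 1) + 2)"
    by (simp add: num_rooted_spanning_forests_eq finite_multigraph_wheel[OF N]
        minimal_rooting_wheel card_image card_staircases)
  moreover have "2 * (N - 1) + 2 = 2 * N"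
    using N by simp
  ultimately show ?thesis
    by (simp only:)
qed

end

theorem corollary3p4:
  fixes N a :: nat
  assumes "N \<ge> 3" and "a \<in> {1..N}"
  shows "\<F> (wheel N) {Center, Rim a} = \<tau> (contract (wheel N) {Center, Rim a})
    \<and> \<tau> (contract (wheel N) {Center, Rim a}) = fib (2 * N)"
proof -
  interpret rooted_wheel N a
    using assms by unfold_locales
  have "{Center, Rim a} \<subseteq> verts (wheel N)"
    using assms by (auto simp: wheel_def)
  then show ?thesis
    using num_rooted_spanning_forests_eq_contract[OF finite_multigraph_wheel[OF assms(1)]]
      num_rooted_spanning_forests_wheel by simp
qed

end
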